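(* For $\alpha\in\mathbb{C}$ let ${\cal A}(\alpha,z)=\cos\alpha\,{\rm Ai}(z)+\sin\alpha\,{\rm Bi}(z)$. (i) For every $\alpha\in\mathbb{C}$, the function $z\mapsto{\cal A}(\alpha,z)$ has negative real zeros if and only if $\Im\alpha=0$; and, for $j\in\{-1,1\}$, it has zeros on the ray $\arg z=j\pi/3$ if and only if $|1-e^{-2ji\alpha}|=1$. (ii) Any solution, not identically zero, of the Airy equation $w''(z)=z\,w(z)$ which has a zero on the ray $\arg z=\pi$, on the ray $\arg z=\pi/3$, or on the ray $\arg z=-\pi/3$, is proportional, respectively, to ${\cal A}(\alpha,z)$, to ${\cal A}(\alpha,z e^{2\pi i/3})$, or to ${\cal A}(\alpha,z e^{-2\pi i/3})$, for some real $\alpha$.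
   Context: ${\rm Ai}$ and ${\rm Bi}$ denote the standard Airy functions of the first and second kind, i.e. the standard pair of linearly independent real solutions of $w''(z)=z\,w(z)$. A ray $\arg z=\phi$ is the open half-line $\{re^{i\phi}: r>0\}$. *)

theory Defs
  imports "HOL-Complex_Analysis.Complex_Analysis"
begin

definition airy_solution :: "(complex \<Rightarrow> complex) \<Rightarrow> bool" where
  "airy_solution w \<longleftrightarrow> w holomorphic_on UNIV \<and> (\<forall>z. deriv (deriv w) z = z * w z)"

text \<open>Maclaurin coefficients of the solution of \<open>w'' = z w\<close> with \<open>w 0 = a\<close>, \<open>w' 0 = b\<close>:
  comparing coefficients of \<open>z^(n+1)\<close> gives \<open>(n+2) (n+3) c(n+3) = c(n)\<close> and \<open>c(2) = 0\<close>.\<close>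

fun airy_coeff :: "real \<Rightarrow> real \<Rightarrow> nat \<Rightarrow> real" where
  "airy_coeff a b 0 = a"
| "airy_coeff a b (Suc 0) = b"
| "airy_coeff a b (Suc (Suc 0)) = 0"
| "airy_coeff a b (Suc (Suc (Suc n))) = airy_coeff a b n / (real (n + 2) * real (n + 3))"

definition airy_ivp :: "real \<Rightarrow> real \<Rightarrow> complex \<Rightarrow> complex" where
  "airy_ivp a b z = (\<Sum>n. of_real (airy_coeff a b n) * z ^ n)"

text \<open>\<open>Ai\<close> and \<open>Bi\<close> are normalised by their standard initial values
  \<open>Ai(0) = 3^(-2/3) / \<Gamma>(2/3)\<close>, \<open>Ai'(0) = - 3^(-1/3) / \<Gamma>(1/3)\<close>,
  \<open>Bi(0) = 3^(-1/6) / \<Gamma>(2/3)\<close>, \<open>Bi'(0) = 3^(1/6) / \<Gamma>(1/3)\<close>.\<close>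

definition Ai :: "complex \<Rightarrow> complex" where
  "Ai = airy_ivp (3 powr (- 2 / 3) / Gamma (2 / 3)) (- (3 powr (- 1 / 3) / Gamma (1 / 3)))"

definition Bi :: "complex \<Rightarrow> complex" where
  "Bi = airy_ivp (3 powr (- 1 / 6) / Gamma (2 / 3)) (3 powr (1 / 6) / Gamma (1 / 3))"

definition airy_comb :: "complex \<Rightarrow> complex \<Rightarrow> complex" where
  "airy_comb \<alpha> z = cos \<alpha> * Ai z + sin \<alpha> * Bi z"

definition ray :: "real \<Rightarrow> complex set" where
  "ray \<phi> = {of_real r * cis \<phi> | r. r > 0}"

text \<open>The power series converges everywhere and does solve the initial value problem.\<close>

lemma airy_coeff_bounded:
  assumes R: "R \<ge> 0"
  obtains K where "\<And>n. \<bar>airy_coeff a b n\<bar> * R ^ n \<le> K"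
proof -
  obtain N :: nat where N: "R ^ 3 \<le> real N"
    using real_arch_simple by blast
  define K where "K = (\<Sum>i<N + 3. \<bar>airy_coeff a b i\<bar> * R ^ i)"
  have "\<bar>airy_coeff a b n\<bar> * R ^ n \<le> K" for n
  proof (induction n rule: less_induct)
    case (less n)
    show ?case
    proof (cases "n < N + 3")
      case True
      then show ?thesis
        unfolding K_def using R by (intro member_le_sum) auto
    next
      case False
      define m where "m = n - 3"
      have n: "n = m + 3" and m: "m \<ge> N"
        using False by (auto simp: m_def)
      have "real N * 1 \<le> real (m + 2) * real (m + 3)"
        using m by (intro mult_mono) auto
      with N have q: "R ^ 3 / (real (m + 2) * real (m + 3)) \<le> 1"
        by (simp add: divide_le_eq_1 del: of_nat_add)
      have "\<bar>airy_coeff a b n\<bar> * R ^ n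
          = (\<bar>airy_coeff a b m\<bar> * R ^ m) * (R ^ 3 / (real (m + 2) * real (m + 3)))"
        by (simp add: n numeral_3_eq_3 abs_mult)
      also have "\<dots> \<le> (\<bar>airy_coeff a b m\<bar> * R ^ m) * 1"
        using q R by (intro mult_left_mono) auto
      also have "\<dots> \<le> K"
        using less[of m] n by simp
      finally show ?thesis .
    qed
  qed
  then show ?thesis using that by blast
qed

lemma airy_summable: "summable (\<lambda>n. of_real (airy_coeff a b n) * (z::complex) ^ n)"
proof -
  define R where "R = norm z + 1"
  have R: "R > norm z" "R > 0"
    by (auto simp: R_def add_nonneg_pos)
  obtain K where K: "\<And>n. \<bar>airy_coeff a b n\<bar> * R ^ n \<le> K"
    using airy_coeff_bounded[of R a b] R by auto
  show ?thesis
  proof (rule summable_comparison_test')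
    show "summable (\<lambda>n. K * (norm z / R) ^ n)"
      using R by (intro summable_mult summable_geometric) auto
    fix n :: nat
    have "norm (of_real (airy_coeff a b n) * z ^ n)
        = (\<bar>airy_coeff a b n\<bar> * R ^ n) * (norm z / R) ^ n"
      using R by (simp add: norm_mult norm_power power_divide)
    also have "\<dots> \<le> K * (norm z / R) ^ n"
      using K R by (intro mult_right_mono) auto
    finally show "norm (of_real (airy_coeff a b n) * z ^ n) \<le> K * (norm z / R) ^ n" .
  qed
qed

lemma airy_ivp_solution:
  shows "airy_solution (airy_ivp a b)"
    and "airy_ivp a b 0 = of_real a"
    and "deriv (airy_ivp a b) 0 = of_real b"
proof -
  define c :: "nat \<Rightarrow> complex" where "c = (\<lambda>n. of_real (airy_coeff a b n))"
  have s0: "summable (\<lambda>n. c n * z ^ n)" for z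
    unfolding c_def by (rule airy_summable)
  have s1: "summable (\<lambda>n. diffs c n * z ^ n)" for z
    using s0 by (rule termdiff_converges_all)
  have s2: "summable (\<lambda>n. diffs (diffs c) n * z ^ n)" for z
    using s1 by (rule termdiff_converges_all)
  have ivp: "airy_ivp a b = (\<lambda>z. \<Sum>n. c n * z ^ n)"
    by (simp add: airy_ivp_def c_def fun_eq_iff)
  have d0: "(airy_ivp a b has_field_derivative (\<Sum>n. diffs c n * z ^ n)) (at z)" for z
    unfolding ivp using s0 by (rule termdiffs_strong_converges_everywhere)
  then have d0': "deriv (airy_ivp a b) = (\<lambda>z. \<Sum>n. diffs c n * z ^ n)"
    by (auto simp: fun_eq_iff intro: DERIV_imp_deriv)
  have d1: "(deriv (airy_ivp a b) has_field_derivative (\<Sum>n. diffs (diffs c) n * z ^ n)) (at z)"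
    for z
    unfolding d0' using s1 by (rule termdiffs_strong_converges_everywhere)
  have c3: "diffs (diffs c) (Suc n) = c n" for n
  proof -
    have "(of_nat (n + 2) :: complex) \<noteq> 0" "(of_nat (n + 3) :: complex) \<noteq> 0"
      by (simp_all only: of_nat_eq_0_iff)
    moreover have "diffs (diffs c) (Suc n) = of_nat (n + 2) * (of_nat (n + 3) * c (n + 3))"
      by (simp add: diffs_def numeral_3_eq_3)
    moreover have "c (n + 3) = c n / (of_nat (n + 2) * of_nat (n + 3))"
      by (simp add: c_def numeral_3_eq_3)
    ultimately show ?thesis by (simp del: of_nat_add)
  qed
  have "(\<Sum>n. diffs (diffs c) n * z ^ n) = z * airy_ivp a b z" for z
  proof -
    have "(\<Sum>n. diffs (diffs c) n * z ^ n)
        = diffs (diffs c) 0 + (\<Sum>n. diffs (diffs c) (Suc n) * z ^ Suc n)"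
      using suminf_split_head[OF s2[of z]] by simp
    also have "\<dots> = (\<Sum>n. z * (c n * z ^ n))"
      by (simp add: c3 mult.left_commute) (simp add: diffs_def c_def)
    also have "\<dots> = z * airy_ivp a b z"
      unfolding ivp by (rule suminf_mult[OF s0])
    finally show ?thesis .
  qed
  with d1 have "deriv (deriv (airy_ivp a b)) z = z * airy_ivp a b z" for z
    by (metis DERIV_imp_deriv)
  moreover have "airy_ivp a b holomorphic_on UNIV"
    using d0 by (auto simp: holomorphic_on_open)
  ultimately show "airy_solution (airy_ivp a b)"
    by (simp add: airy_solution_def)
  show "airy_ivp a b 0 = of_real a"
    by (simp add: ivp c_def powser_zero)
  show "deriv (airy_ivp a b) 0 = of_real b"
    by (simp add: d0' powser_zero diffs_def c_def)
qed

end

theory Submission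
  imports Defs
begin

text \<open>
  Let \<open>f\<close> and \<open>g\<close> be the solutions of \<open>w'' = z w\<close> with \<open>(w(0), w'(0))\<close> equal to \<open>(1, 0)\<close> and
  \<open>(0, 1)\<close>. Every solution is \<open>p f + q g\<close>, so a solution is, up to a factor, a point \<open>(p : q)\<close> of
  the complex projective line. All the claims come from one fact
  (\<open>negative_zero_iff\<close>): \<open>p f + q g\<close> vanishes somewhere on the negative axis if and only if
  \<open>(p : q)\<close> is a real point, that is, \<open>Im (p * cnj q) = 0\<close>. In one direction, \<open>f\<close> and \<open>g\<close> are real on
  the real axis and have no common zero there, because their Wronskian is 1. In the other direction,
  a real solution must vanish, by Sturm comparison with the sine function: to the left of
  \<open>-1\<close> the equation oscillates at least as fast as \<open>u'' = - u\<close>.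

  The other two rays reduce to the negative axis by rotation. If \<open>\<zeta>\<^sup>3 = 1\<close> then
  \<open>f (\<zeta> z) = f z\<close> and \<open>g (\<zeta> z) = \<zeta> g z\<close>, so rotating the argument only multiplies \<open>q\<close> by \<open>\<zeta>\<close>
  (\<open>ray_zero_iff\<close>).

  It remains to write \<open>cos \<alpha> Ai + sin \<alpha> Bi\<close> in this basis. Up to positive factors its
  coordinates are \<open>P = cos \<alpha> + \<surd>3 sin \<alpha>\<close> and \<open>Q = \<surd>3 sin \<alpha> - cos \<alpha>\<close>. For part (i), write
  \<open>\<alpha> = a + i b\<close>; then \<open>P * cnj Q = (cosh 2b - 2 cos 2a) - i \<surd>3 sinh 2b\<close>, from which the
  reality conditions are read off for the three cube roots of unity. For part (ii), real \<open>\<alpha>\<close>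
  give exactly the real points \<open>(P : Q)\<close>, since \<open>P\<close> and \<open>Q\<close> are independent
  real linear forms in \<open>cos \<alpha>\<close> and \<open>sin \<alpha>\<close>.
\<close>

section \<open>The solution space\<close>

text \<open>Naming the derivative \<open>v\<close> replaces iterated \<open>deriv\<close> by a first-order system, for which
  the rules for computing derivatives apply directly.\<close>

lemma airy_solution_iff_system:
  "airy_solution w \<longleftrightarrow>
     (\<exists>v. (\<forall>z. (w has_field_derivative v z) (at z)) \<and>
          (\<forall>z. (v has_field_derivative z * w z) (at z)))"
proof
  assume w: "airy_solution w"
  then have hol: "w holomorphic_on UNIV" and eq: "deriv (deriv w) z = z * w z" for z
    by (auto simp: airy_solution_def)
  have hol': "deriv w holomorphic_on UNIV"
    using hol by (rule holomorphic_deriv) simp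
  have "(w has_field_derivative deriv w z) (at z)" for z
    using hol by (rule holomorphic_derivI) auto
  moreover have "(deriv w has_field_derivative z * w z) (at z)" for z
    using holomorphic_derivI[OF hol', of z] by (simp add: eq)
  ultimately show "\<exists>v. (\<forall>z. (w has_field_derivative v z) (at z)) \<and>
          (\<forall>z. (v has_field_derivative z * w z) (at z))"
    by blast
next
  assume "\<exists>v. (\<forall>z. (w has_field_derivative v z) (at z)) \<and>
          (\<forall>z. (v has_field_derivative z * w z) (at z))"
  then obtain v where v: "\<And>z. (w has_field_derivative v z) (at z)"
    and v': "\<And>z. (v has_field_derivative z * w z) (at z)"
    by blast
  have "deriv w = v"
    using v by (auto intro: DERIV_imp_deriv)
  then show "airy_solution w"
    using v v' by (auto simp: airy_solution_def holomorphic_on_open intro: DERIV_imp_deriv)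
qed

lemma airy_solutionE:
  assumes "airy_solution w"
  shows "(w has_field_derivative deriv w z) (at z)"
    and "(deriv w has_field_derivative z * w z) (at z)"
proof -
  obtain v where v: "\<And>z. (w has_field_derivative v z) (at z)"
    and v': "\<And>z. (v has_field_derivative z * w z) (at z)"
    using assms by (auto simp: airy_solution_iff_system)
  have "deriv w = v"
    using v by (auto intro: DERIV_imp_deriv)
  then show "(w has_field_derivative deriv w z) (at z)"
    and "(deriv w has_field_derivative z * w z) (at z)"
    using v v' by auto
qed

text \<open>Abel's identity: the equation has no first-order term, so the derivative of the Wronskian
  vanishes.\<close>

lemma airy_wronskian_constant:
  assumes u: "airy_solution u" and w: "airy_solution w"
  shows "u z * deriv w z - deriv u z * w z = u 0 * deriv w 0 - deriv u 0 * w 0"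
proof -
  have "((\<lambda>z. u z * deriv w z - deriv u z * w z) has_field_derivative 0) (at x)" for x
    by (rule derivative_eq_intros airy_solutionE[OF u] airy_solutionE[OF w] refl)+
       (simp add: algebra_simps)
  then have "(\<lambda>z. u z * deriv w z - deriv u z * w z) constant_on UNIV"
    by (intro has_field_derivative_0_imp_constant_on) auto
  then show ?thesis
    unfolding constant_on_def by auto
qed

abbreviation airy_f :: "complex \<Rightarrow> complex" where "airy_f \<equiv> airy_ivp 1 0"
abbreviation airy_g :: "complex \<Rightarrow> complex" where "airy_g \<equiv> airy_ivp 0 1"

lemma airy_fg_wronskian: "airy_f z * deriv airy_g z - deriv airy_f z * airy_g z = 1"
  by (subst airy_wronskian_constant) (simp_all add: airy_ivp_solution)

text \<open>The expansion is Cramer's rule, read off from the fact that the three Wronskians of \<open>w\<close>, \<open>f\<close>, \<open>g\<close>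
  are constant, with known values at 0.\<close>

lemma airy_solution_expand:
  assumes w: "airy_solution w"
  shows "w z = w 0 * airy_f z + deriv w 0 * airy_g z"
proof -
  have 1: "w z * deriv airy_g z - deriv w z * airy_g z = w 0"
    using airy_wronskian_constant[OF w airy_ivp_solution(1)[of 0 1], of z]
    by (simp add: airy_ivp_solution)
  have 2: "w z * deriv airy_f z - deriv w z * airy_f z = - deriv w 0"
    using airy_wronskian_constant[OF w airy_ivp_solution(1)[of 1 0], of z]
    by (simp add: airy_ivp_solution)
  have "w 0 * airy_f z - (- deriv w 0) * airy_g z
      = w z * (airy_f z * deriv airy_g z - deriv airy_f z * airy_g z)"
    unfolding 1[symmetric] 2[symmetric] by (simp add: algebra_simps)
  then show ?thesis
    by (simp add: airy_fg_wronskian)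
qed

lemma airy_ivp_expand: "airy_ivp a b z = of_real a * airy_f z + of_real b * airy_g z"
  using airy_solution_expand[OF airy_ivp_solution(1)[of a b], of z]
  by (simp add: airy_ivp_solution)

text \<open>The equation \<open>w'' = z w\<close> is invariant under \<open>z \<mapsto> \<zeta> z\<close> because \<open>\<zeta>\<^sup>2 (\<zeta> z) = z\<close>.\<close>

lemma airy_solution_rotate:
  assumes w: "airy_solution w" and \<zeta>: "\<zeta> ^ 3 = 1"
  shows "airy_solution (\<lambda>z. w (\<zeta> * z))"
    and "deriv (\<lambda>z. w (\<zeta> * z)) 0 = \<zeta> * deriv w 0"
proof -
  have rot: "((\<lambda>z. \<zeta> * z) has_field_derivative \<zeta>) (at z)" for z
    by (rule derivative_eq_intros refl)+ simp
  have d: "((\<lambda>z. w (\<zeta> * z)) has_field_derivative \<zeta> * deriv w (\<zeta> * z)) (at z)" for z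
    using DERIV_chain2[OF airy_solutionE(1)[OF w] rot, of z] by (simp add: mult.commute[of "deriv w (\<zeta> * z)"])
  have "((\<lambda>z. \<zeta> * deriv w (\<zeta> * z)) has_field_derivative z * w (\<zeta> * z)) (at z)" for z
  proof -
    have "\<zeta> * (\<zeta> * z * w (\<zeta> * z) * \<zeta>) = \<zeta> ^ 3 * (z * w (\<zeta> * z))"
      by (simp add: power3_eq_cube)
    also have "\<dots> = z * w (\<zeta> * z)"
      by (simp add: \<zeta>)
    finally show ?thesis
      using DERIV_cmult[OF DERIV_chain2[OF airy_solutionE(2)[OF w] rot], of \<zeta> z] by (simp only:)
  qed
  with d show "airy_solution (\<lambda>z. w (\<zeta> * z))"
    unfolding airy_solution_iff_system by (intro exI[of _ "\<lambda>z. \<zeta> * deriv w (\<zeta> * z)"]) simp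
  show "deriv (\<lambda>z. w (\<zeta> * z)) 0 = \<zeta> * deriv w 0"
    using d[of 0] by (simp add: DERIV_imp_deriv)
qed

lemma airy_fg_rotate:
  assumes "\<zeta> ^ 3 = 1"
  shows "airy_f (\<zeta> * z) = airy_f z" and "airy_g (\<zeta> * z) = \<zeta> * airy_g z"
proof -
  note f = airy_solution_rotate[OF airy_ivp_solution(1)[of 1 0] assms]
  show "airy_f (\<zeta> * z) = airy_f z"
    using airy_solution_expand[OF f(1), of z] by (simp add: f(2) airy_ivp_solution)
  note g = airy_solution_rotate[OF airy_ivp_solution(1)[of 0 1] assms]
  show "airy_g (\<zeta> * z) = \<zeta> * airy_g z"
    using airy_solution_expand[OF g(1), of z] by (simp add: g(2) airy_ivp_solution)
qed

section \<open>Zeros on the negative axis and on the rotated rays\<close>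

lemma airy_ivp_real: "airy_ivp a b (of_real x) = of_real (\<Sum>n. airy_coeff a b n * x ^ n)"
proof -
  have s: "summable (\<lambda>n. complex_of_real (airy_coeff a b n * x ^ n))"
    using airy_summable[of a b "of_real x"] by simp
  then show ?thesis
    using suminf_of_real[of "\<lambda>n. airy_coeff a b n * x ^ n", where ?'a = complex]
    by (simp add: airy_ivp_def flip: summable_of_real_iff[where ?'a = complex])
qed

text \<open>Sturm comparison with \<open>s(x) = sin (-1 - x)\<close> on \<open>[-1 - \<pi>, -1]\<close>. If \<open>u'' = x u\<close> and \<open>u > 0\<close>,
  then \<open>(u' s - u s')' = (x + 1) u s \<le> 0\<close> on this interval, whereas
  \<open>u' s - u s'\<close> is \<open>- u(-1 - \<pi>) < 0\<close> at the left end and \<open>u(-1) > 0\<close> at the right end.\<close>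

lemma sturm_not_positive:
  fixes u v :: "real \<Rightarrow> real"
  assumes u: "\<And>x. (u has_real_derivative v x) (at x)"
    and v: "\<And>x. (v has_real_derivative x * u x) (at x)"
    and pos: "\<And>x. x < 0 \<Longrightarrow> u x > 0"
  shows False
proof -
  define W where "W = (\<lambda>x. v x * sin (- 1 - x) + u x * cos (- 1 - x))"
  have W': "(W has_real_derivative (x + 1) * u x * sin (- 1 - x)) (at x)" for x
    unfolding W_def
    by (rule derivative_eq_intros u v refl)+ (simp add: algebra_simps)
  have "W (- 1) \<le> W (- 1 - pi)"
  proof (rule DERIV_nonpos_imp_nonincreasing[of "- 1 - pi"])
    show "- 1 - pi \<le> - 1" by simp
    fix x :: real assume x: "- 1 - pi \<le> x" "x \<le> - 1"
    have "sin (- 1 - x) \<ge> 0"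
      using x by (intro sin_ge_zero) auto
    moreover have "(x + 1) * u x \<le> 0"
      using x pos[of x] by (intro mult_nonpos_nonneg) auto
    ultimately have "(x + 1) * u x * sin (- 1 - x) \<le> 0"
      by (rule mult_nonpos_nonneg[rotated])
    with W' show "\<exists>y. (W has_real_derivative y) (at x) \<and> y \<le> 0"
      by blast
  qed
  moreover have "W (- 1) = u (- 1)" "W (- 1 - pi) = - u (- 1 - pi)"
    by (simp_all add: W_def)
  moreover have "u (- 1) > 0" "u (- 1 - pi) > 0"
    using pi_gt_zero by (intro pos; linarith)+
  ultimately show False
    by linarith
qed

text \<open>The equation has real coefficients on the real axis, so there the real part of a
  solution is again a solution. If it had no zero, it would have constant sign by the intermediate
  value theorem, and it or its negative would contradict the Sturm comparison.\<close>

lemma airy_solution_Re_zero: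
  assumes w: "airy_solution w"
  shows "\<exists>x<0. Re (w (of_real x)) = 0"
proof (rule ccontr)
  define u v where "u = (\<lambda>x::real. Re (w (of_real x)))"
    and "v = (\<lambda>x::real. Re (deriv w (of_real x)))"
  assume "\<not> ?thesis"
  then have nz: "u x \<noteq> 0" if "x < 0" for x
    using that by (auto simp: u_def)
  have Re_deriv: "((\<lambda>x. Re (h (of_real x))) has_real_derivative Re h') (at x)"
    if "(h has_field_derivative h') (at (complex_of_real x))" for h h' x
    unfolding has_real_derivative_iff_has_vector_derivative
    using that by (intro bounded_linear.has_vector_derivative[OF bounded_linear_Re]
        has_vector_derivative_real_field)
  have u: "(u has_real_derivative v x) (at x)" for x
    unfolding u_def v_def by (rule Re_deriv) (rule airy_solutionE(1)[OF w])
  have v: "(v has_real_derivative x * u x) (at x)" for x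
    using Re_deriv[OF airy_solutionE(2)[OF w, of "of_real x"]]
    by (simp add: u_def v_def)
  have cont: "continuous_on S u" for S
    using u by (intro continuous_at_imp_continuous_on) (auto intro: DERIV_isCont)
  have same_sign: "u x > 0 \<longleftrightarrow> u (- 1) > 0" if "x < 0" for x
  proof (rule ccontr)
    assume *: "\<not> ?thesis"
    have "connected (u ` {..<0})"
      by (intro connected_continuous_image cont) auto
    moreover have "u x \<in> u ` {..<0}" "u (- 1) \<in> u ` {..<0}"
      using that by auto
    ultimately have "0 \<in> u ` {..<0}"
      using * unfolding connected_iff_interval by (meson not_less order_less_imp_le)
    with nz show False by force
  qed
  show False
  proof (cases "u (- 1) > 0")
    case True
    then show False
      using sturm_not_positive[OF u v] same_sign by blast
  next
    case False
    have "- u x > 0" if "x < 0" for x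
      using same_sign[OF that] False nz[OF that] by linarith
    then show False
      by (intro sturm_not_positive[of "\<lambda>x. - u x" "\<lambda>x. - v x"])
         (auto intro!: derivative_eq_intros u v)
  qed
qed

text \<open>A point of the complex projective line fixed by conjugation has real homogeneous
  coordinates.\<close>

lemma Im_mult_cnj_eq_0_imp_real_direction:
  assumes "Im (p * cnj q) = 0" and "p \<noteq> 0 \<or> q \<noteq> 0"
  obtains c :: complex and a b :: real
  where "c \<noteq> 0" "p = c * of_real a" "q = c * of_real b"
proof (cases "q = 0")
  case True
  with assms that[of p 1 0] show ?thesis by simp
next
  case False
  have "Im (p / q) = 0"
    using assms(1) by (simp add: complex_div_cnj[of p q])
  then have "p / q = of_real (Re (p / q))"
    by (simp add: complex_eq_iff)
  then have "p = q * of_real (Re (p / q))"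
    using False by (simp add: field_simps)
  with False that[of q "Re (p / q)" 1] show ?thesis by simp
qed

lemma negative_zero_iff:
  assumes "p \<noteq> 0 \<or> q \<noteq> 0"
  shows "(\<exists>x<0. p * airy_f (of_real x) + q * airy_g (of_real x) = 0) \<longleftrightarrow> Im (p * cnj q) = 0"
proof
  assume "\<exists>x<0. p * airy_f (of_real x) + q * airy_g (of_real x) = 0"
  then obtain x where x: "p * airy_f (of_real x) + q * airy_g (of_real x) = 0"
    by blast
  obtain F G :: real where FG: "airy_f (of_real x) = of_real F" "airy_g (of_real x) = of_real G"
    by (auto simp: airy_ivp_real)
  have "F \<noteq> 0 \<or> G \<noteq> 0"
    using airy_fg_wronskian[of "of_real x"] by (auto simp: FG)
  moreover have pq: "p * of_real F + q * of_real G = 0"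
    using x by (simp add: FG)
  then have "Re p * F + Re q * G = 0" "Im p * F + Im q * G = 0"
    by (simp_all add: complex_eq_iff)
  then have "F * (Im p * Re q - Re p * Im q) = 0" "G * (Im p * Re q - Re p * Im q) = 0"
    by algebra+
  ultimately show "Im (p * cnj q) = 0"
    by auto
next
  assume "Im (p * cnj q) = 0"
  then obtain c a b where c: "c \<noteq> 0" "p = c * of_real a" "q = c * of_real b"
    using assms by (rule Im_mult_cnj_eq_0_imp_real_direction)
  obtain x where "x < 0" and x: "Re (airy_ivp a b (of_real x)) = 0"
    using airy_solution_Re_zero[OF airy_ivp_solution(1)] by blast
  have "airy_ivp a b (of_real x) = 0"
    using x by (simp add: airy_ivp_real)
  then have "p * airy_f (of_real x) + q * airy_g (of_real x) = 0"
    using airy_ivp_expand[of a b "of_real x"] by (simp add: c mult.assoc flip: distrib_left)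
  with \<open>x < 0\<close> show "\<exists>x<0. p * airy_f (of_real x) + q * airy_g (of_real x) = 0"
    by blast
qed

text \<open>Since \<open>cis \<phi> = - \<zeta>\<close>, the ray at angle \<open>\<phi>\<close> is the negative axis rotated by \<open>\<zeta>\<close>, and
  this rotation turns \<open>p f + q g\<close> into \<open>p f + q \<zeta> g\<close>.\<close>

lemma ray_zero_iff:
  assumes "p \<noteq> 0 \<or> q \<noteq> 0" and \<zeta>: "\<zeta> ^ 3 = 1" "cis \<phi> = - \<zeta>"
  shows "(\<exists>z\<in>ray \<phi>. p * airy_f z + q * airy_g z = 0) \<longleftrightarrow> Im (p * cnj (q * \<zeta>)) = 0"
proof -
  have "ray \<phi> = (\<lambda>x. \<zeta> * of_real x) ` {..<0}"
  proof (intro equalityI subsetI)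
    fix z assume "z \<in> ray \<phi>"
    then obtain r where "r > 0" "z = of_real r * cis \<phi>"
      by (auto simp: ray_def)
    then show "z \<in> (\<lambda>x. \<zeta> * of_real x) ` {..<0}"
      by (intro image_eqI[of _ _ "- r"]) (auto simp: \<zeta>)
  next
    fix z assume "z \<in> (\<lambda>x. \<zeta> * of_real x) ` {..<0}"
    then obtain x where "x < 0" "z = \<zeta> * of_real x"
      by auto
    then show "z \<in> ray \<phi>"
      unfolding ray_def by (auto simp: \<zeta> intro!: exI[of _ "- x"])
  qed
  then have "(\<exists>z\<in>ray \<phi>. p * airy_f z + q * airy_g z = 0) \<longleftrightarrow>
      (\<exists>x<0. p * airy_f (of_real x) + (q * \<zeta>) * airy_g (of_real x) = 0)"
    by (auto simp: airy_fg_rotate[OF \<zeta>(1)] mult.assoc Bex_def)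
  moreover have "p \<noteq> 0 \<or> q * \<zeta> \<noteq> 0"
    using assms(1) \<zeta>(1) by auto
  ultimately show ?thesis
    using negative_zero_iff by presburger
qed

section \<open>The coordinates of the Airy functions\<close>

definition airy_c1 :: real where "airy_c1 = 3 powr (- 2 / 3) / Gamma (2 / 3)"
definition airy_c2 :: real where "airy_c2 = 3 powr (- 1 / 3) / Gamma (1 / 3)"

lemma airy_c1_pos: "airy_c1 > 0" and airy_c2_pos: "airy_c2 > 0"
  by (auto simp: airy_c1_def airy_c2_def intro!: divide_pos_pos Gamma_real_pos)

definition comb_P :: "complex \<Rightarrow> complex" where
  "comb_P \<alpha> = cos \<alpha> + of_real (sqrt 3) * sin \<alpha>"
definition comb_Q :: "complex \<Rightarrow> complex" where
  "comb_Q \<alpha> = of_real (sqrt 3) * sin \<alpha> - cos \<alpha>"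

text \<open>\<open>Bi(0) = \<surd>3 Ai(0)\<close> and \<open>Bi'(0) = - \<surd>3 Ai'(0)\<close>, so both functions are described by the
  two constants \<open>Ai(0)\<close> and \<open>- Ai'(0)\<close>.\<close>

lemma airy_comb_expand:
  "airy_comb \<alpha> z = of_real airy_c1 * comb_P \<alpha> * airy_f z + of_real airy_c2 * comb_Q \<alpha> * airy_g z"
proof -
  have powr: "(3::real) powr (- 1 / 6) = sqrt 3 * 3 powr (- 2 / 3)"
       "(3::real) powr (1 / 6) = sqrt 3 * 3 powr (- 1 / 3)"
    by (simp_all add: powr_half_sqrt[symmetric] flip: powr_add)
  have "Ai z = of_real airy_c1 * airy_f z - of_real airy_c2 * airy_g z"
    unfolding Ai_def by (subst airy_ivp_expand) (simp add: airy_c1_def airy_c2_def)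
  moreover have "Bi z = of_real (sqrt 3) *
      (of_real airy_c1 * airy_f z + of_real airy_c2 * airy_g z)"
    unfolding Bi_def powr
    by (subst airy_ivp_expand) (simp add: airy_c1_def airy_c2_def algebra_simps)
  ultimately show ?thesis
    unfolding airy_comb_def comb_P_def comb_Q_def by algebra
qed

lemma comb_PQ_nonzero: "comb_P \<alpha> \<noteq> 0 \<or> comb_Q \<alpha> \<noteq> 0"
proof (rule ccontr)
  assume "\<not> ?thesis"
  then have "comb_P \<alpha> - comb_Q \<alpha> = 0" "comb_P \<alpha> + comb_Q \<alpha> = 0"
    by auto
  then have "cos \<alpha> = 0" "sin \<alpha> = 0"
    by (auto simp: comb_P_def comb_Q_def)
  then show False
    using sin_cos_squared_add[of \<alpha>] by simp
qed

text \<open>The product-to-sum formula for \<open>P = 2 cos (\<alpha> - \<pi>/3)\<close> and \<open>Q = 2 cos (\<alpha> - 2\<pi>/3)\<close>,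
  with \<open>\<alpha> + cnj \<alpha> = 2 Re \<alpha>\<close> and \<open>\<alpha> - cnj \<alpha> = 2 i Im \<alpha>\<close>.\<close>

lemma comb_PQ_product:
  shows "Re (comb_P \<alpha> * cnj (comb_Q \<alpha>))
           = (exp (2 * Im \<alpha>) + exp (- 2 * Im \<alpha>)) / 2 - 2 * cos (2 * Re \<alpha>)"
    and "Im (comb_P \<alpha> * cnj (comb_Q \<alpha>))
           = - sqrt 3 * (exp (2 * Im \<alpha>) - exp (- 2 * Im \<alpha>)) / 2"
proof -
  define c s C S r where "c = cos (Re \<alpha>)" and "s = sin (Re \<alpha>)"
    and "C = (exp (Im \<alpha>) + exp (- Im \<alpha>)) / 2" and "S = (exp (Im \<alpha>) - exp (- Im \<alpha>)) / 2"
    and "r = sqrt 3"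
  have rel: "c\<^sup>2 + s\<^sup>2 = 1" "C\<^sup>2 - S\<^sup>2 = 1" "r\<^sup>2 = 3"
    by (simp_all add: c_def s_def C_def S_def r_def power2_eq_square field_simps flip: exp_add)
  have hyp: "(exp (2 * Im \<alpha>) + exp (- 2 * Im \<alpha>)) / 2 = C\<^sup>2 + S\<^sup>2"
    "(exp (2 * Im \<alpha>) - exp (- 2 * Im \<alpha>)) / 2 = 2 * S * C"
    by (simp_all add: C_def S_def power2_eq_square field_simps flip: exp_add)
  have double: "cos (2 * Re \<alpha>) = c\<^sup>2 - s\<^sup>2"
    by (simp add: cos_double c_def s_def)
  have trig: "Re (cos \<alpha>) = c * C" "Im (cos \<alpha>) = - s * S"
    "Re (sin \<alpha>) = s * C" "Im (sin \<alpha>) = c * S"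
    by (simp_all add: c_def s_def C_def S_def Re_cos Im_cos Re_sin Im_sin field_simps)
  have "Re (comb_P \<alpha> * cnj (comb_Q \<alpha>))
      = (c * C + r * (s * C)) * (r * (s * C) - c * C)
      + (r * (c * S) - s * S) * (r * (c * S) + s * S)"
    by (simp add: comb_P_def comb_Q_def trig algebra_simps flip: r_def)
  also have "\<dots> = C\<^sup>2 + S\<^sup>2 - 2 * (c\<^sup>2 - s\<^sup>2)"
    using rel by algebra
  finally show "Re (comb_P \<alpha> * cnj (comb_Q \<alpha>))
      = (exp (2 * Im \<alpha>) + exp (- 2 * Im \<alpha>)) / 2 - 2 * cos (2 * Re \<alpha>)"
    by (simp only: hyp double)
  have "Im (comb_P \<alpha> * cnj (comb_Q \<alpha>))
      = (r * (c * S) - s * S) * (r * (s * C) - c * C)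
      - (c * C + r * (s * C)) * (r * (c * S) + s * S)"
    by (simp add: comb_P_def comb_Q_def trig algebra_simps flip: r_def)
  also have "\<dots> = - r * (2 * S * C)"
    using rel by algebra
  finally show "Im (comb_P \<alpha> * cnj (comb_Q \<alpha>))
      = - sqrt 3 * (exp (2 * Im \<alpha>) - exp (- 2 * Im \<alpha>)) / 2"
    using hyp(2) by (simp add: r_def)
qed

lemma airy_comb_ray_zero_iff:
  assumes "\<zeta> ^ 3 = 1" "cis \<phi> = - \<zeta>"
  shows "(\<exists>z\<in>ray \<phi>. airy_comb \<alpha> z = 0) \<longleftrightarrow> Im (comb_P \<alpha> * cnj (comb_Q \<alpha> * \<zeta>)) = 0"
proof -
  have "of_real airy_c1 * comb_P \<alpha> \<noteq> 0 \<or> of_real airy_c2 * comb_Q \<alpha> \<noteq> 0"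
    using airy_c1_pos airy_c2_pos comb_PQ_nonzero[of \<alpha>] by auto
  from ray_zero_iff[OF this assms]
  have "(\<exists>z\<in>ray \<phi>. airy_comb \<alpha> z = 0) \<longleftrightarrow>
      Im (of_real airy_c1 * comb_P \<alpha> * cnj (of_real airy_c2 * comb_Q \<alpha> * \<zeta>)) = 0"
    by (simp add: airy_comb_expand)
  also have "of_real airy_c1 * comb_P \<alpha> * cnj (of_real airy_c2 * comb_Q \<alpha> * \<zeta>)
      = of_real (airy_c1 * airy_c2) * (comb_P \<alpha> * cnj (comb_Q \<alpha> * \<zeta>))"
    by simp
  also have "Im \<dots> = 0 \<longleftrightarrow> Im (comb_P \<alpha> * cnj (comb_Q \<alpha> * \<zeta>)) = 0"
    using airy_c1_pos airy_c2_pos by (subst times_complex.sel) simp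
  finally show ?thesis .
qed

section \<open>Zeros of the combinations, and solutions with a zero on a ray\<close>

lemma airy_comb_negative_zero_iff:
  "(\<exists>x<0. airy_comb \<alpha> (of_real x) = 0) \<longleftrightarrow> Im \<alpha> = 0"
proof -
  have "ray pi = of_real ` {..<0}"
  proof (intro equalityI subsetI)
    fix z assume "z \<in> complex_of_real ` {..<0}"
    then obtain x where "x < 0" "z = of_real x"
      by auto
    then show "z \<in> ray pi"
      unfolding ray_def by (auto intro!: exI[of _ "- x"])
  next
    fix z assume "z \<in> ray pi"
    then obtain r where "r > 0" "z = of_real (- r)"
      by (auto simp: ray_def)
    then show "z \<in> complex_of_real ` {..<0}"
      by (intro image_eqI) auto
  qed
  then have "(\<exists>x<0. airy_comb \<alpha> (of_real x) = 0) \<longleftrightarrow> (\<exists>z\<in>ray pi. airy_comb \<alpha> z = 0)"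
    by (auto simp: Bex_def)
  also have "\<dots> \<longleftrightarrow> Im (comb_P \<alpha> * cnj (comb_Q \<alpha>)) = 0"
    using airy_comb_ray_zero_iff[of 1 pi \<alpha>] by simp
  also have "\<dots> \<longleftrightarrow> Im \<alpha> = 0"
    unfolding comb_PQ_product(2) by simp
  finally show ?thesis .
qed

text \<open>The Cartesian form of \<open>exp (- 2 t \<pi> i / 3)\<close>, the cube root of unity opposite to the
  ray at angle \<open>t \<pi>/3\<close>; rotating by its inverse takes that ray to the negative axis.\<close>

lemma cube_root_of_unity_ray:
  fixes t :: real
  assumes "t = 1 \<or> t = - 1"
  shows "Complex (- 1 / 2) (- t * sqrt 3 / 2) ^ 3 = 1"
    and "cis (t * pi / 3) = - Complex (- 1 / 2) (- t * sqrt 3 / 2)"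
    and "Complex (- 1 / 2) (- t * sqrt 3 / 2) * exp (2 * of_real t * of_real pi * \<i> / 3) = 1"
proof -
  have t: "t * (t * x) = x" for x
    using assms by auto
  show 1: "Complex (- 1 / 2) (- t * sqrt 3 / 2) ^ 3 = 1"
    by (simp add: power3_eq_cube complex_eq_iff t algebra_simps)
  show 2: "cis (t * pi / 3) = - Complex (- 1 / 2) (- t * sqrt 3 / 2)"
    using assms by (auto simp: complex_eq_iff cos_60 sin_60)
  let ?\<zeta> = "Complex (- 1 / 2) (- t * sqrt 3 / 2)"
  have "exp (2 * of_real t * of_real pi * \<i> / 3) = cis (t * pi / 3) ^ 2"
    by (simp add: cis_conv_exp exp_of_nat_mult[symmetric] algebra_simps)
  then have "?\<zeta> * exp (2 * of_real t * of_real pi * \<i> / 3) = ?\<zeta> ^ 3"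
    by (simp only: 2 power2_eq_square power3_eq_cube) simp
  then show "?\<zeta> * exp (2 * of_real t * of_real pi * \<i> / 3) = 1"
    by (simp only: 1)
qed

text \<open>With \<open>x = exp (2 t Im \<alpha>)\<close>, both sides say that \<open>x = 2 cos (2 Re \<alpha>)\<close>: the left because
  \<open>cosh + t sinh\<close> is an exponential, the right because \<open>|1 - w|\<^sup>2 = 1\<close> amounts to
  \<open>|w|\<^sup>2 = 2 Re w\<close>.\<close>

lemma airy_comb_sixth_ray_zero_iff:
  fixes t :: real
  assumes t: "t = 1 \<or> t = - 1"
  shows "(\<exists>z\<in>ray (t * pi / 3). airy_comb \<alpha> z = 0) \<longleftrightarrow>
         norm (1 - exp (- 2 * of_real t * \<i> * \<alpha>)) = 1"
proof -
  define x where "x = exp (2 * t * Im \<alpha>)"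
  have x: "x > 0"
    by (simp add: x_def)
  let ?\<zeta> = "Complex (- 1 / 2) (- t * sqrt 3 / 2)"
  have "Im (comb_P \<alpha> * cnj (comb_Q \<alpha> * ?\<zeta>)) = Im (comb_P \<alpha> * cnj (comb_Q \<alpha>) * cnj ?\<zeta>)"
    by (simp only: complex_cnj_mult mult.assoc)
  also have "\<dots> = Re (comb_P \<alpha> * cnj (comb_Q \<alpha>)) * (t * sqrt 3 / 2)
      - Im (comb_P \<alpha> * cnj (comb_Q \<alpha>)) / 2"
    by (subst times_complex.sel(2)) (simp del: times_complex.sel)
  also have "\<dots> = t * sqrt 3 / 2 * (x - 2 * cos (2 * Re \<alpha>))"
    unfolding comb_PQ_product using t by (auto simp: x_def field_simps)
  finally have Im_eq: "Im (comb_P \<alpha> * cnj (comb_Q \<alpha> * ?\<zeta>)) = \<dots>" .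
  have L: "(\<exists>z\<in>ray (t * pi / 3). airy_comb \<alpha> z = 0) \<longleftrightarrow> x = 2 * cos (2 * Re \<alpha>)"
    unfolding airy_comb_ray_zero_iff[OF cube_root_of_unity_ray(1,2)[OF t]] Im_eq using t by auto
  define w where "w = exp (- 2 * of_real t * \<i> * \<alpha>)"
  have w: "norm w = x" "Re w = x * cos (2 * Re \<alpha>)"
    using t by (auto simp: w_def x_def norm_exp_eq_Re Re_exp)
  have "norm (1 - w) = 1 \<longleftrightarrow> (norm (1 - w))\<^sup>2 = 1"
    using abs_square_eq_1[of "norm (1 - w)"] by simp
  also have "(norm (1 - w))\<^sup>2 = 1 - 2 * Re w + (norm w)\<^sup>2"
    by (simp only: cmod_power2) (simp add: power2_eq_square algebra_simps)
  also have "\<dots> = 1 \<longleftrightarrow> x * x = x * (2 * cos (2 * Re \<alpha>))"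
    by (auto simp: w power2_eq_square)
  also have "\<dots> \<longleftrightarrow> x = 2 * cos (2 * Re \<alpha>)"
    using x by simp
  finally show ?thesis
    using L by (simp add: w_def)
qed

text \<open>Inverting the linear forms \<open>P\<close>, \<open>Q\<close> and passing to polar coordinates.\<close>

lemma real_initial_values_proportional_airy_comb:
  fixes a b :: real
  assumes "a \<noteq> 0 \<or> b \<noteq> 0"
  obtains \<alpha> k :: real
  where "k \<noteq> 0" "of_real a = of_real k * (of_real airy_c1 * comb_P (of_real \<alpha>))"
    "of_real b = of_real k * (of_real airy_c2 * comb_Q (of_real \<alpha>))"
proof -
  define X Y where "X = (a / airy_c1 - b / airy_c2) / 2"
    and "Y = (a / airy_c1 + b / airy_c2) / (2 * sqrt 3)"
  have ab: "a = airy_c1 * (X + sqrt 3 * Y)" "b = airy_c2 * (sqrt 3 * Y - X)"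
    using airy_c1_pos airy_c2_pos by (simp_all add: X_def Y_def field_simps)
  obtain k \<alpha> where XY: "X = k * cos \<alpha>" "Y = k * sin \<alpha>"
    using polar_Ex[of X Y] by blast
  have "k \<noteq> 0"
    using assms ab XY by auto
  moreover have "of_real a = of_real k * (of_real airy_c1 * comb_P (of_real \<alpha>))"
    by (simp add: ab(1) XY comb_P_def cos_of_real sin_of_real algebra_simps)
  moreover have "of_real b = of_real k * (of_real airy_c2 * comb_Q (of_real \<alpha>))"
    by (simp add: ab(2) XY comb_Q_def cos_of_real sin_of_real algebra_simps)
  ultimately show ?thesis
    by (rule that)
qed

text \<open>\<open>ray_zero_iff\<close> makes \<open>(p : q \<zeta>)\<close> a real point, hence the point of some \<open>airy_comb \<alpha>\<close>
  with real \<open>\<alpha>\<close>; the inverse rotation \<open>\<eta> = 1/\<zeta>\<close> in the argument turns \<open>q \<zeta>\<close> back into \<open>q\<close>.\<close>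

lemma airy_solution_ray_zero_imp_proportional:
  assumes w: "airy_solution w" "w z0 \<noteq> 0"
    and zero: "\<exists>z\<in>ray \<phi>. w z = 0"
    and \<zeta>: "\<zeta> ^ 3 = 1" "cis \<phi> = - \<zeta>" "\<zeta> * \<eta> = 1"
  shows "\<exists>(\<alpha>::real) c. c \<noteq> 0 \<and> (\<forall>z. w z = c * airy_comb (of_real \<alpha>) (z * \<eta>))"
proof -
  define p q where "p = w 0" and "q = deriv w 0"
  have w_eq: "w z = p * airy_f z + q * airy_g z" for z
    unfolding p_def q_def using w(1) by (rule airy_solution_expand)
  have nz: "p \<noteq> 0 \<or> q \<noteq> 0"
    using w(2) by (auto simp: w_eq)
  have "Im (p * cnj (q * \<zeta>)) = 0"
    using zero ray_zero_iff[OF nz \<zeta>(1,2)] by (simp add: w_eq)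
  moreover have "p \<noteq> 0 \<or> q * \<zeta> \<noteq> 0"
    using nz \<zeta>(1) by auto
  ultimately obtain c a b where c: "c \<noteq> 0" "p = c * of_real a" "q * \<zeta> = c * of_real b"
    by (rule Im_mult_cnj_eq_0_imp_real_direction)
  then have "a \<noteq> 0 \<or> b \<noteq> 0"
    using nz \<zeta>(1) by auto
  then obtain \<alpha> k :: real where k: "k \<noteq> 0"
    and a: "of_real a = of_real k * (of_real airy_c1 * comb_P (of_real \<alpha>))"
    and b: "of_real b = of_real k * (of_real airy_c2 * comb_Q (of_real \<alpha>))"
    by (rule real_initial_values_proportional_airy_comb)
  have "\<eta> ^ 3 = 1"
    using \<zeta>(1,3) by (metis mult_1 one_power2 power_mult_distrib power_one)
  note rotate = airy_fg_rotate[OF this]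
  have q: "q = c * of_real b * \<eta>"
    using c(3) \<zeta>(3) by (metis mult.assoc mult.right_neutral)
  have "w z = c * of_real k * airy_comb (of_real \<alpha>) (z * \<eta>)" for z
    by (simp add: w_eq c(2) q a b airy_comb_expand mult.commute[of z \<eta>] rotate algebra_simps)
  with c(1) k show ?thesis
    by (intro exI[of _ \<alpha>] exI[of _ "c * of_real k"]) auto
qed

theorem theorem3:
  shows "(\<forall>\<alpha>::complex.
            ((\<exists>x::real. x < 0 \<and> airy_comb \<alpha> (of_real x) = 0) \<longleftrightarrow> Im \<alpha> = 0) \<and>
            (\<forall>j\<in>{-1, 1::int}.
               (\<exists>z\<in>ray (of_int j * pi / 3). airy_comb \<alpha> z = 0) \<longleftrightarrow>
               norm (1 - exp (- 2 * of_int j * \<i> * \<alpha>)) = 1))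
       \<and> (\<forall>w. airy_solution w \<and> (\<exists>z. w z \<noteq> 0) \<longrightarrow>
            ((\<exists>z\<in>ray pi. w z = 0) \<longrightarrow>
               (\<exists>(\<alpha>::real) c::complex. c \<noteq> 0 \<and>
                  (\<forall>z. w z = c * airy_comb (of_real \<alpha>) z))) \<and>
            ((\<exists>z\<in>ray (pi / 3). w z = 0) \<longrightarrow>
               (\<exists>(\<alpha>::real) c::complex. c \<noteq> 0 \<and>
                  (\<forall>z. w z = c * airy_comb (of_real \<alpha>) (z * exp (2 * of_real pi * \<i> / 3))))) \<and>
            ((\<exists>z\<in>ray (- pi / 3). w z = 0) \<longrightarrow>
               (\<exists>(\<alpha>::real) c::complex. c \<noteq> 0 \<and>
                  (\<forall>z. w z = c * airy_comb (of_real \<alpha>) (z * exp (- 2 * of_real pi * \<i> / 3))))))"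
proof (intro conjI allI ballI impI)
  fix \<alpha> :: complex
  show "(\<exists>x::real. x < 0 \<and> airy_comb \<alpha> (of_real x) = 0) \<longleftrightarrow> Im \<alpha> = 0"
    by (rule airy_comb_negative_zero_iff)
  fix j :: int assume "j \<in> {-1, 1}"
  then have "real_of_int j = 1 \<or> real_of_int j = - 1"
    by auto
  from airy_comb_sixth_ray_zero_iff[OF this, of \<alpha>]
  show "(\<exists>z\<in>ray (of_int j * pi / 3). airy_comb \<alpha> z = 0) \<longleftrightarrow>
      norm (1 - exp (- 2 * of_int j * \<i> * \<alpha>)) = 1"
    by simp
next
  fix w assume w: "airy_solution w \<and> (\<exists>z. w z \<noteq> 0)"
  then obtain z0 where z0: "w z0 \<noteq> 0" by blast
  note proportional = airy_solution_ray_zero_imp_proportional[OF conjunct1[OF w] z0]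
  show "\<exists>(\<alpha>::real) c::complex. c \<noteq> 0 \<and> (\<forall>z. w z = c * airy_comb (of_real \<alpha>) z)"
    if "\<exists>z\<in>ray pi. w z = 0"
    using proportional[OF that, of 1 1] by simp
  show "\<exists>(\<alpha>::real) c::complex. c \<noteq> 0 \<and>
      (\<forall>z. w z = c * airy_comb (of_real \<alpha>) (z * exp (2 * of_real pi * \<i> / 3)))"
    if "\<exists>z\<in>ray (pi / 3). w z = 0"
    using proportional[OF that] cube_root_of_unity_ray[of 1] by simp
  show "\<exists>(\<alpha>::real) c::complex. c \<noteq> 0 \<and>
      (\<forall>z. w z = c * airy_comb (of_real \<alpha>) (z * exp (- 2 * of_real pi * \<i> / 3)))"
    if "\<exists>z\<in>ray (- pi / 3). w z = 0"
    using proportional[OF that] cube_root_of_unity_ray[of "- 1"] by simp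
qed

end
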